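(* Let $X$ be a strongly $0$-dimensional metrizable space which is $\sigma$-compact and satisfies $3\le\operatorname{card}(X)\le\mathfrak{c}$. Then the set $\mathrm{R}(X)$ is comeager in $(\mathrm{Met}(X),\mathcal{D}_X)$.
   Context: For a topological space $X$, $\mathrm{Met}(X)$ denotes the set of all metrics on $X$ generating the topology of $X$, equipped with the supremum metric $\mathcal{D}_X(d,e)=\sup_{x,y\in X}|d(x,y)-e(x,y)|$ (values in $[0,\infty]$) and the topology generated by its open balls. $\mathfrak{c}$ is the cardinality of the continuum. A topological space is strongly $0$-dimensional if for every pair $A,B$ of disjoint closed subsets there is a clopen set $V$ with $A\subseteq V$, $V\cap B=\emptyset$. A metric $d$ on $X$ is rigid if every bijective isometry $f\colon(X,d)\to(X,d)$ is the identity; $\mathrm{R}(X)$ is the set of rigid metrics in $\mathrm{Met}(X)$. A subset of a topological space is comeager if it contains a dense $G_\delta$ subset. *)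

theory Defs
  imports "HOL-Analysis.Analysis" "HOL-Library.Equipollence"
begin

definition strongly_zero_dimensional :: "'a topology \<Rightarrow> bool" where
  "strongly_zero_dimensional X \<longleftrightarrow>
     (\<forall>A B. closedin X A \<and> closedin X B \<and> A \<inter> B = {} \<longrightarrow>
        (\<exists>V. closedin X V \<and> openin X V \<and> A \<subseteq> V \<and> V \<inter> B = {}))"

definition sigma_compact_space :: "'a topology \<Rightarrow> bool" where
  "sigma_compact_space X \<longleftrightarrow>
     (\<exists>\<C>. countable \<C> \<and> (\<forall>K\<in>\<C>. compactin X K) \<and> \<Union>\<C> = topspace X)"

(* Met(X): metrics on the carrier of X generating the topology of X.
   A metric is a function 'a => 'a => real; to obtain one representative per
   metric on topspace X we normalise its values outside topspace X to 0. *)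
definition Met :: "'a topology \<Rightarrow> ('a \<Rightarrow> 'a \<Rightarrow> real) set" where
  "Met X = {d. Metric_space (topspace X) d \<and>
               Metric_space.mtopology (topspace X) d = X \<and>
               (\<forall>x y. x \<notin> topspace X \<or> y \<notin> topspace X \<longrightarrow> d x y = 0)}"

definition supD :: "'a topology \<Rightarrow> ('a \<Rightarrow> 'a \<Rightarrow> real) \<Rightarrow> ('a \<Rightarrow> 'a \<Rightarrow> real) \<Rightarrow> ennreal" where
  "supD X d e = (SUP p\<in>topspace X \<times> topspace X. ennreal \<bar>d (fst p) (snd p) - e (fst p) (snd p)\<bar>)"

definition Met_topology :: "'a topology \<Rightarrow> ('a \<Rightarrow> 'a \<Rightarrow> real) topology" where
  "Met_topology X = topology (arbitrary union_of
      (\<lambda>U. \<exists>d\<in>Met X. \<exists>r>0. U = {e\<in>Met X. supD X d e < ennreal r}))"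

definition rigid_metric :: "'a topology \<Rightarrow> ('a \<Rightarrow> 'a \<Rightarrow> real) \<Rightarrow> bool" where
  "rigid_metric X d \<longleftrightarrow>
     (\<forall>f. bij_betw f (topspace X) (topspace X) \<and>
          (\<forall>x\<in>topspace X. \<forall>y\<in>topspace X. d (f x) (f y) = d x y)
          \<longrightarrow> (\<forall>x\<in>topspace X. f x = x))"

definition R :: "'a topology \<Rightarrow> ('a \<Rightarrow> 'a \<Rightarrow> real) set" where
  "R X = {d\<in>Met X. rigid_metric X d}"

definition comeager_in :: "'b topology \<Rightarrow> 'b set \<Rightarrow> bool" where
  "comeager_in T A \<longleftrightarrow>
     (\<exists>G. G \<subseteq> A \<and> gdelta_in T G \<and> T closure_of G = topspace T)"

end

theory Submission
  imports Defs
begin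

text \<open>
  Call \<open>d\<close> generic if \<open>d x y \<noteq> d u v\<close> whenever \<open>x, y, u\<close> are distinct. An isometry \<open>f\<close> of a generic
  metric maps \<open>x\<close> into \<open>{x, y} \<inter> {x, z} = {x}\<close> as soon as there are two further points \<open>y, z\<close>,
  so generic metrics are rigid. By \<open>\<sigma>\<close>-compactness genericity is a countable conjunction of
  conditions demanding that \<open>d x y\<close> and \<open>d u v\<close> differ by some \<open>\<delta> > 0\<close> for all \<open>x, y, u, v\<close> in a
  compact set with \<open>x, y, u\<close> at least \<open>1/n\<close> apart. Each condition is open. It is also dense: take a
  partition into clopen pieces of small diameter, keep \<open>d\<close> inside the pieces, and replace it
  between different pieces by constants that are pairwise distinct; a compact set meets only
  finitely many pieces. Finally, the space of continuous pseudometrics is complete under the sup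
  metric and, again by \<open>\<sigma>\<close>-compactness, the metrics generating the topology form a
  \<open>G\<^sub>\<delta>\<close> set in it, so the Baire category theorem applies.
\<close>

section \<open>The complete space of continuous pseudometrics\<close>

text \<open>Distinct points may have distance 0, since a uniform limit of metrics need only be a
  pseudometric. By the triangle inequality the fourth clause amounts to joint continuity of
  \<open>d\<close>. Values off the carrier are fixed to 0, as in \<open>Met\<close>, so that sup
  distance 0 means equality.\<close>

definition continuous_pmets :: "'a topology \<Rightarrow> ('a \<Rightarrow> 'a \<Rightarrow> real) set" where
  "continuous_pmets X = {d.
     (\<forall>x\<in>topspace X. d x x = 0) \<and>
     (\<forall>x\<in>topspace X. \<forall>y\<in>topspace X. d x y = d y x) \<and>
     (\<forall>x\<in>topspace X. \<forall>y\<in>topspace X. \<forall>z\<in>topspace X. d x z \<le> d x y + d y z) \<and>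
     (\<forall>x\<in>topspace X. \<forall>\<epsilon>>0. \<exists>U. openin X U \<and> x \<in> U \<and> (\<forall>y\<in>U. d x y < \<epsilon>)) \<and>
     (\<forall>x y. x \<notin> topspace X \<or> y \<notin> topspace X \<longrightarrow> d x y = 0)}"

lemma continuous_pmetsD:
  assumes "d \<in> continuous_pmets X"
  shows "x \<in> topspace X \<Longrightarrow> d x x = 0"
    and "d x y = d y x"
    and "x \<in> topspace X \<Longrightarrow> y \<in> topspace X \<Longrightarrow> z \<in> topspace X \<Longrightarrow> d x z \<le> d x y + d y z"
    and "x \<in> topspace X \<Longrightarrow> \<epsilon> > 0 \<Longrightarrow> \<exists>U. openin X U \<and> x \<in> U \<and> (\<forall>y\<in>U. d x y < \<epsilon>)"
    and "x \<notin> topspace X \<or> y \<notin> topspace X \<Longrightarrow> d x y = 0"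
proof -
  show "d x y = 0" if "x \<notin> topspace X \<or> y \<notin> topspace X"
    using assms that by (simp add: continuous_pmets_def)
  show "d x y = d y x"
    using assms by (cases "x \<in> topspace X \<and> y \<in> topspace X") (auto simp: continuous_pmets_def)
qed (use assms in \<open>simp_all add: continuous_pmets_def\<close>)

lemma continuous_pmets_nonneg:
  assumes "d \<in> continuous_pmets X"
  shows "0 \<le> d x y"
proof (cases "x \<in> topspace X \<and> y \<in> topspace X")
  case True
  then show ?thesis
    using continuous_pmetsD(1)[OF assms, of x] continuous_pmetsD(3)[OF assms, of x y x]
      continuous_pmetsD(2)[OF assms, of x y] by linarith
qed (simp add: continuous_pmetsD(5)[OF assms])

text \<open>The first condition says that \<open>d\<close>-balls are neighbourhoods in
  \<open>X\<close>, so that the metric topology is coarser; the second says that it is finer. They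
  are kept apart because only the first survives uniform limits; the second later becomes the
  G-delta condition.\<close>

lemma mtopology_eq_iff:
  assumes "Metric_space (topspace X) d"
  shows "Metric_space.mtopology (topspace X) d = X \<longleftrightarrow>
    (\<forall>x\<in>topspace X. \<forall>\<epsilon>>0. \<exists>U. openin X U \<and> x \<in> U \<and> (\<forall>y\<in>U. d x y < \<epsilon>)) \<and>
    (\<forall>U x. openin X U \<and> x \<in> U \<longrightarrow> (\<exists>\<epsilon>>0. \<forall>y\<in>topspace X. d x y < \<epsilon> \<longrightarrow> y \<in> U))"
    (is "?L \<longleftrightarrow> ?A \<and> ?B")
proof -
  interpret M: Metric_space "topspace X" d by fact
  show ?thesis
  proof (intro iffI conjI)
    assume L: ?L
    show ?A
    proof (intro ballI allI impI)
      fix x and \<epsilon> :: real assume "x \<in> topspace X" "\<epsilon> > 0"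
      moreover have "openin X (M.mball x \<epsilon>)"
        using M.openin_mball[of x \<epsilon>] unfolding L .
      ultimately show "\<exists>U. openin X U \<and> x \<in> U \<and> (\<forall>y\<in>U. d x y < \<epsilon>)"
        by (intro exI[of _ "M.mball x \<epsilon>"]) auto
    qed
    show ?B
    proof (intro allI impI)
      fix U x assume "openin X U \<and> x \<in> U"
      then have "openin M.mtopology U" "x \<in> U" unfolding L by auto
      then obtain r where "r > 0" "M.mball x r \<subseteq> U" "x \<in> topspace X"
        unfolding M.openin_mtopology by blast
      then show "\<exists>\<epsilon>>0. \<forall>y\<in>topspace X. d x y < \<epsilon> \<longrightarrow> y \<in> U"
        by (intro exI[of _ r]) (auto simp: subset_iff)
    qed
  next
    assume AB: "?A \<and> ?B"
    show ?L
    proof (rule topology_eq[THEN iffD2, rule_format])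
      fix S
      show "openin M.mtopology S \<longleftrightarrow> openin X S"
      proof
        assume S: "openin M.mtopology S"
        show "openin X S"
        proof (subst openin_subopen, intro ballI)
          fix x assume "x \<in> S"
          then obtain r where r: "r > 0" "M.mball x r \<subseteq> S" "x \<in> topspace X"
            using S unfolding M.openin_mtopology by blast
          obtain U where "openin X U" "x \<in> U" "\<forall>y\<in>U. d x y < r"
            using conjunct1[OF AB, rule_format, OF r(3,1)] by auto
          moreover have "U \<subseteq> topspace X" using \<open>openin X U\<close> by (rule openin_subset)
          ultimately show "\<exists>T. openin X T \<and> x \<in> T \<and> T \<subseteq> S"
            using r by (intro exI[of _ U]) (auto simp: subset_iff)
        qed
      next
        assume S: "openin X S"
        then have "S \<subseteq> topspace X" by (rule openin_subset)
        moreover have "\<exists>r>0. M.mball x r \<subseteq> S" if xS: "x \<in> S" for x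
        proof -
          obtain r where "r > 0" "\<forall>y\<in>topspace X. d x y < r \<longrightarrow> y \<in> S"
            using conjunct2[OF AB, rule_format, OF conjI[OF S xS]] by auto
          then show ?thesis by (intro exI[of _ r]) (auto simp: subset_iff)
        qed
        ultimately show "openin M.mtopology S" by (simp add: M.openin_mtopology)
      qed
    qed
  qed
qed

text \<open>Positivity comes for free: in a Hausdorff space some open set contains \<open>x\<close>
  but not a given other point \<open>y\<close>, so the condition on open sets excludes
  \<open>d x y = 0\<close>. Thus this single condition cuts \<open>Met X\<close> out of
  \<open>continuous_pmets X\<close>.\<close>

lemma Met_eq:
  assumes "Hausdorff_space X"
  shows "Met X = {d \<in> continuous_pmets X.
    \<forall>U x. openin X U \<and> x \<in> U \<longrightarrow> (\<exists>\<epsilon>>0. \<forall>y\<in>topspace X. d x y < \<epsilon> \<longrightarrow> y \<in> U)}"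
proof (intro set_eqI iffI)
  fix d assume "d \<in> Met X"
  then have d: "Metric_space (topspace X) d" "Metric_space.mtopology (topspace X) d = X"
    "\<forall>x y. x \<notin> topspace X \<or> y \<notin> topspace X \<longrightarrow> d x y = 0"
    by (auto simp: Met_def)
  interpret M: Metric_space "topspace X" d by fact
  have "d \<in> continuous_pmets X"
    unfolding continuous_pmets_def mem_Collect_eq
    by (intro conjI ballI d(3) conjunct1[OF iffD1[OF mtopology_eq_iff[OF d(1)] d(2)]])
      (simp_all add: M.commute M.triangle)
  with conjunct2[OF iffD1[OF mtopology_eq_iff[OF d(1)] d(2)]]
  show "d \<in> {d \<in> continuous_pmets X.
    \<forall>U x. openin X U \<and> x \<in> U \<longrightarrow> (\<exists>\<epsilon>>0. \<forall>y\<in>topspace X. d x y < \<epsilon> \<longrightarrow> y \<in> U)}"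
    by blast
next
  fix d assume "d \<in> {d \<in> continuous_pmets X.
    \<forall>U x. openin X U \<and> x \<in> U \<longrightarrow> (\<exists>\<epsilon>>0. \<forall>y\<in>topspace X. d x y < \<epsilon> \<longrightarrow> y \<in> U)}"
  then have P: "d \<in> continuous_pmets X" and
    B: "\<forall>U x. openin X U \<and> x \<in> U \<longrightarrow> (\<exists>\<epsilon>>0. \<forall>y\<in>topspace X. d x y < \<epsilon> \<longrightarrow> y \<in> U)"
    by auto
  have M: "Metric_space (topspace X) d"
  proof
    fix x y z
    show "0 \<le> d x y" by (rule continuous_pmets_nonneg[OF P])
    show "d x y = d y x" by (rule continuous_pmetsD(2)[OF P])
    assume x: "x \<in> topspace X" and y: "y \<in> topspace X"
    show "d x y = 0 \<longleftrightarrow> x = y"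
    proof
      assume 0: "d x y = 0"
      show "x = y"
      proof (rule ccontr)
        assume "x \<noteq> y"
        then obtain U where "openin X U" "x \<in> U" "y \<notin> U"
          using assms x y unfolding Hausdorff_space_def disjnt_def by (metis disjoint_iff)
        then show False using B 0 y by force
      qed
    qed (use continuous_pmetsD(1)[OF P x] in auto)
    show "z \<in> topspace X \<Longrightarrow> d x z \<le> d x y + d y z"
      by (rule continuous_pmetsD(3)[OF P x y])
  qed
  have "Metric_space.mtopology (topspace X) d = X"
    unfolding mtopology_eq_iff[OF M]
    by (intro conjI ballI allI impI continuous_pmetsD(4)[OF P] B[rule_format]) auto
  then show "d \<in> Met X"
    unfolding Met_def using M continuous_pmetsD(5)[OF P] by blast
qed

section \<open>The supremum distance and its truncation\<close>

lemma supD_le_iff: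
  assumes "c \<ge> 0"
  shows "supD X d e \<le> ennreal c \<longleftrightarrow> (\<forall>x\<in>topspace X. \<forall>y\<in>topspace X. \<bar>d x y - e x y\<bar> \<le> c)"
  using assms by (auto simp: supD_def SUP_le_iff ennreal_le_iff)

lemma supD_self: "supD X d d = 0"
  using supD_le_iff[of 0 X d d] by simp

lemma supD_commute: "supD X d e = supD X e d"
  unfolding supD_def by (simp add: abs_minus_commute)

lemma supD_triangle: "supD X d f \<le> supD X d e + supD X e f"
  unfolding supD_def[of X d f]
proof (rule SUP_least)
  fix p assume p: "p \<in> topspace X \<times> topspace X"
  let ?a = "\<bar>d (fst p) (snd p) - e (fst p) (snd p)\<bar>"
  let ?b = "\<bar>e (fst p) (snd p) - f (fst p) (snd p)\<bar>"
  have "ennreal \<bar>d (fst p) (snd p) - f (fst p) (snd p)\<bar> \<le> ennreal (?a + ?b)"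
    by (intro ennreal_leI) auto
  also have "\<dots> = ennreal ?a + ennreal ?b" by simp
  also have "\<dots> \<le> supD X d e + supD X e f"
    unfolding supD_def using p by (intro add_mono SUP_upper2[OF p]) auto
  finally show "ennreal \<bar>d (fst p) (snd p) - f (fst p) (snd p)\<bar> \<le> supD X d e + supD X e f" .
qed

text \<open>Truncation makes the extended metric \<^const>\<open>supD\<close> real-valued
  without changing balls of radius at most 1.\<close>

definition trunc_supD :: "'a topology \<Rightarrow> ('a \<Rightarrow> 'a \<Rightarrow> real) \<Rightarrow> ('a \<Rightarrow> 'a \<Rightarrow> real) \<Rightarrow> real" where
  "trunc_supD X d e = enn2real (min 1 (supD X d e))"

lemma ennreal_trunc_supD: "ennreal (trunc_supD X d e) = min 1 (supD X d e)"
  unfolding trunc_supD_def by (intro ennreal_enn2real) (simp add: min.strict_coboundedI1)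

lemma trunc_supD_nonneg: "0 \<le> trunc_supD X d e"
  by (simp add: trunc_supD_def)

lemma trunc_supD_less_iff:
  assumes "0 < r" "r \<le> 1"
  shows "trunc_supD X d e < r \<longleftrightarrow> supD X d e < ennreal r"
proof -
  have "trunc_supD X d e < r \<longleftrightarrow> ennreal (trunc_supD X d e) < ennreal r"
    using trunc_supD_nonneg by (subst ennreal_less_iff) auto
  also have "\<dots> \<longleftrightarrow> supD X d e < ennreal r"
    using assms by (auto simp: ennreal_trunc_supD min_less_iff_disj ennreal_less_one_iff
        ennreal_1[symmetric] ennreal_less_iff simp del: ennreal_1)
  finally show ?thesis .
qed

lemma trunc_supD_lessD:
  assumes "trunc_supD X d e < r" "r \<le> 1" "x \<in> topspace X" "y \<in> topspace X"
  shows "\<bar>d x y - e x y\<bar> < r"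
proof -
  \<comment> \<open>\<open>supD_le_iff\<close> gives only a non-strict pointwise bound, so it is
    applied at a midpoint that still lies below \<open>r\<close>.\<close>
  define s where "s = (trunc_supD X d e + r) / 2"
  have s: "trunc_supD X d e < s" "s < r" "0 < s"
    using assms trunc_supD_nonneg[of X d e] by (auto simp: s_def)
  then have "supD X d e \<le> ennreal s"
    using trunc_supD_less_iff[of s X d e] assms by auto
  then show ?thesis using supD_le_iff[of s X d e] s assms by fastforce
qed

lemma trunc_supD_leI:
  assumes "\<And>x y. x \<in> topspace X \<Longrightarrow> y \<in> topspace X \<Longrightarrow> \<bar>d x y - e x y\<bar> \<le> r" "0 \<le> r"
  shows "trunc_supD X d e \<le> r"
proof -
  have "supD X d e \<le> ennreal r" using assms supD_le_iff by blast
  then have "ennreal (trunc_supD X d e) \<le> ennreal r"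
    unfolding ennreal_trunc_supD by (simp add: min.coboundedI2)
  then show ?thesis using assms(2) by simp
qed

lemma Metric_space_continuous_pmets: "Metric_space (continuous_pmets X) (trunc_supD X)"
proof
  fix d e f :: "'a \<Rightarrow> 'a \<Rightarrow> real"
  show "0 \<le> trunc_supD X d e" by (rule trunc_supD_nonneg)
  show "trunc_supD X d e = trunc_supD X e d"
    by (simp add: trunc_supD_def supD_commute)
  assume P: "d \<in> continuous_pmets X" "e \<in> continuous_pmets X"
  show "trunc_supD X d e = 0 \<longleftrightarrow> d = e"
  proof
    assume 0: "trunc_supD X d e = 0"
    have "d x y = e x y" for x y
    proof (cases "x \<in> topspace X \<and> y \<in> topspace X")
      case True
      \<comment> \<open>If the values differed, distance 0 would lie below the positive radius
        \<open>min 1 \<bar>d x y - e x y\<bar>\<close>, and the difference would be smaller than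
        itself.\<close>
      show ?thesis
        using trunc_supD_lessD[of X d e "min 1 \<bar>d x y - e x y\<bar>" x y] 0 True by fastforce
    qed (use P in \<open>auto simp: continuous_pmets_def\<close>)
    then show "d = e" by blast
  qed (simp add: trunc_supD_def supD_self)
next
  fix d e f :: "'a \<Rightarrow> 'a \<Rightarrow> real"
  have "min 1 (supD X d f) \<le> min 1 (supD X d e) + min 1 (supD X e f)"
  \<comment> \<open>If one summand on the right is truncated to 1, it alone bounds the left side;
    otherwise truncation leaves the right side unchanged and \<open>supD_triangle\<close>
    applies.\<close>
  proof (cases "1 \<le> supD X d e \<or> 1 \<le> supD X e f")
    case True
    then show ?thesis
      by (auto simp: min_absorb1 intro: min.coboundedI1 add_increasing add_increasing2)
  next
    case False
    then have "min 1 (supD X d e) = supD X d e" "min 1 (supD X e f) = supD X e f" by auto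
    then show ?thesis using supD_triangle[of X d f e] by (simp add: min.coboundedI2)
  qed
  then have "ennreal (trunc_supD X d f) \<le> ennreal (trunc_supD X d e + trunc_supD X e f)"
    by (simp add: ennreal_trunc_supD trunc_supD_nonneg)
  then show "trunc_supD X d f \<le> trunc_supD X d e + trunc_supD X e f"
    using trunc_supD_nonneg by (metis add_nonneg_nonneg ennreal_le_iff)
qed

section \<open>Completeness under uniform convergence\<close>

text \<open>Equations and non-strict inequalities pass to the pointwise limit; continuity at
  \<open>x\<close> is inherited from a single \<open>s N\<close> that is uniformly within
  \<open>\<epsilon> / 2\<close> of the limit.\<close>

lemma Cauchy_pointwise_limit:
  fixes s :: "nat \<Rightarrow> 'a \<Rightarrow> 'a \<Rightarrow> real"
  assumes s: "range s \<subseteq> continuous_pmets X"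
    and Cauchy: "\<And>\<epsilon>. \<epsilon> > 0 \<Longrightarrow> \<exists>N. \<forall>m\<ge>N. \<forall>n\<ge>N. \<forall>x y. \<bar>s m x y - s n x y\<bar> < \<epsilon>"
  obtains d where "d \<in> continuous_pmets X"
    and "\<And>\<epsilon>. \<epsilon> > 0 \<Longrightarrow> \<exists>N. \<forall>n\<ge>N. \<forall>x y. \<bar>s n x y - d x y\<bar> \<le> \<epsilon>"
proof -
  define d where "d x y = lim (\<lambda>n. s n x y)" for x y
  have P: "s n \<in> continuous_pmets X" for n using s by auto
  have lim: "(\<lambda>n. s n x y) \<longlonglongrightarrow> d x y" for x y
  proof -
    have "Cauchy (\<lambda>n. s n x y)"
      unfolding Cauchy_def dist_real_def using Cauchy by meson
    then show ?thesis
      unfolding d_def by (simp add: Cauchy_convergent_iff convergent_LIMSEQ_iff)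
  qed
  have unif: "\<exists>N. \<forall>n\<ge>N. \<forall>x y. \<bar>s n x y - d x y\<bar> \<le> \<epsilon>" if e: "\<epsilon> > 0" for \<epsilon>
  proof -
    obtain N where N: "\<forall>m\<ge>N. \<forall>n\<ge>N. \<forall>x y. \<bar>s m x y - s n x y\<bar> < \<epsilon>"
      using Cauchy[OF e] by blast
    have "\<bar>s n x y - d x y\<bar> \<le> \<epsilon>" if "n \<ge> N" for n x y
    \<comment> \<open>The second index of the Cauchy estimate is sent to infinity, which turns the
      strict bound into a non-strict one.\<close>
    proof (rule LIMSEQ_le_const2)
      show "(\<lambda>m. \<bar>s n x y - s m x y\<bar>) \<longlonglongrightarrow> \<bar>s n x y - d x y\<bar>"
        by (intro tendsto_intros lim)
      show "\<exists>M. \<forall>m\<ge>M. \<bar>s n x y - s m x y\<bar> \<le> \<epsilon>"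
        using N that by (meson less_imp_le)
    qed
    then show ?thesis by blast
  qed
  have "d \<in> continuous_pmets X"
    unfolding continuous_pmets_def mem_Collect_eq
  proof (intro conjI ballI allI impI)
    fix x y z assume x: "x \<in> topspace X"
    show "d x x = 0"
      by (rule LIMSEQ_unique[OF lim]) (simp add: continuous_pmetsD(1)[OF P x])
    assume y: "y \<in> topspace X"
    show "d x y = d y x"
      by (rule LIMSEQ_unique[OF lim], subst continuous_pmetsD(2)[OF P], rule lim)
    assume z: "z \<in> topspace X"
    show "d x z \<le> d x y + d y z"
      by (rule LIMSEQ_le[OF lim tendsto_add[OF lim lim]])
        (use continuous_pmetsD(3)[OF P x y z] in auto)
  next
    fix x and \<epsilon> :: real assume x: "x \<in> topspace X" and e: "\<epsilon> > 0"
    obtain N where N: "\<forall>n\<ge>N. \<forall>x y. \<bar>s n x y - d x y\<bar> \<le> \<epsilon> / 2"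
      using unif[of "\<epsilon> / 2"] e by auto
    obtain U where U: "openin X U" "x \<in> U" "\<forall>y\<in>U. s N x y < \<epsilon> / 2"
      using continuous_pmetsD(4)[OF P x, of "\<epsilon> / 2"] e by auto
    have "d x y < \<epsilon>" if "y \<in> U" for y
      using N[rule_format, of N x y] U(3)[rule_format, OF that] by linarith
    with U show "\<exists>U. openin X U \<and> x \<in> U \<and> (\<forall>y\<in>U. d x y < \<epsilon>)" by blast
  next
    fix x y assume "x \<notin> topspace X \<or> y \<notin> topspace X"
    then show "d x y = 0"
      by (intro LIMSEQ_unique[OF lim]) (simp add: continuous_pmetsD(5)[OF P])
  qed
  with unif show thesis by (rule that[rotated])
qed

lemma mcomplete_continuous_pmets:
  "Metric_space.mcomplete (continuous_pmets X) (trunc_supD X)"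
proof -
  interpret P: Metric_space "continuous_pmets X" "trunc_supD X"
    by (rule Metric_space_continuous_pmets)
  show ?thesis
    unfolding P.mcomplete_def
  proof (intro allI impI)
    fix s assume "P.MCauchy s"
    then have s: "range s \<subseteq> continuous_pmets X"
      and C: "\<And>\<epsilon>. \<epsilon> > 0 \<Longrightarrow> \<exists>N. \<forall>m n. N \<le> m \<longrightarrow> N \<le> n \<longrightarrow> trunc_supD X (s m) (s n) < \<epsilon>"
      by (auto simp: P.MCauchy_def)
    have "\<exists>N. \<forall>m\<ge>N. \<forall>n\<ge>N. \<forall>x y. \<bar>s m x y - s n x y\<bar> < \<epsilon>" if e: "\<epsilon> > 0" for \<epsilon>
    proof -
      \<comment> \<open>The radius is capped at 1 because beyond it \<open>trunc_supD\<close>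
        carries no information about pointwise differences.\<close>
      obtain N where N: "\<forall>m n. N \<le> m \<longrightarrow> N \<le> n \<longrightarrow> trunc_supD X (s m) (s n) < min 1 \<epsilon>"
        using C[of "min 1 \<epsilon>"] e by auto
      have "\<bar>s m x y - s n x y\<bar> < \<epsilon>" if "m \<ge> N" "n \<ge> N" for m n x y
      proof (cases "x \<in> topspace X \<and> y \<in> topspace X")
        case True
        then show ?thesis
          using trunc_supD_lessD[of X "s m" "s n" "min 1 \<epsilon>" x y] N that by auto
      next
        case False
        have "s k x y = 0" for k
          using continuous_pmetsD(5)[of "s k" X x y] s False by auto
        then show ?thesis using \<open>\<epsilon> > 0\<close> by simp
      qed
      then show ?thesis by blast
    qed
    from Cauchy_pointwise_limit[OF s this] obtain d where d: "d \<in> continuous_pmets X"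
      and lim: "\<And>\<epsilon>. \<epsilon> > 0 \<Longrightarrow> \<exists>N. \<forall>n\<ge>N. \<forall>x y. \<bar>s n x y - d x y\<bar> \<le> \<epsilon>"
      by blast
    have "\<exists>N. \<forall>n\<ge>N. s n \<in> continuous_pmets X \<and> trunc_supD X (s n) d < \<epsilon>" if e: "\<epsilon> > 0" for \<epsilon>
    proof -
      obtain N where N: "\<forall>n\<ge>N. \<forall>x y. \<bar>s n x y - d x y\<bar> \<le> \<epsilon> / 2"
        using lim[of "\<epsilon> / 2"] e by auto
      have "trunc_supD X (s n) d \<le> \<epsilon> / 2" if "n \<ge> N" for n
        using N that \<open>\<epsilon> > 0\<close> by (intro trunc_supD_leI) auto
      then show ?thesis using s e by fastforce
    qed
    then have "limitin P.mtopology s d sequentially"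
      using d by (simp add: P.limit_metric_sequentially)
    then show "\<exists>d. limitin P.mtopology s d sequentially" by (rule exI[of _ d])
  qed
qed

section \<open>Complete metrizability of the space of metrics\<close>

text \<open>\<open>topology_base_unique\<close> shows at once that the \<open>supD\<close>-balls
  form a base and that they generate the subspace topology: they are open by the triangle
  inequality, and balls of radius at most 1 agree with those of \<open>trunc_supD\<close>.\<close>

lemma Met_topology_eq:
  assumes "Hausdorff_space X"
  shows "Met_topology X = subtopology
    (Metric_space.mtopology (continuous_pmets X) (trunc_supD X)) (Met X)"
  unfolding Met_topology_def
proof (rule topology_base_unique)
  interpret P: Metric_space "continuous_pmets X" "trunc_supD X"
    by (rule Metric_space_continuous_pmets)
  have sub: "Met X \<subseteq> continuous_pmets X" using Met_eq[OF assms] by blast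
  {
    fix B assume "\<exists>d\<in>Met X. \<exists>r>0. B = {e \<in> Met X. supD X d e < ennreal r}"
    then obtain d r where d: "d \<in> Met X" "r > 0" and B: "B = {e \<in> Met X. supD X d e < ennreal r}"
      by blast
    have "openin P.mtopology {e \<in> continuous_pmets X. supD X d e < ennreal r}"
      unfolding P.openin_mtopology
    proof (intro conjI allI impI)
      fix e assume e: "e \<in> {e \<in> continuous_pmets X. supD X d e < ennreal r}"
      define a where "a = enn2real (supD X d e)"
      have a: "supD X d e = ennreal a" "0 \<le> a" "a < r"
      proof -
        show 1: "supD X d e = ennreal a"
          unfolding a_def using e by (subst ennreal_enn2real) (auto intro: less_trans)
        show 2: "0 \<le> a" by (simp add: a_def)
        show "a < r" using e 1 2 d by (simp add: ennreal_less_iff)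
      qed
      \<comment> \<open>Half of the slack \<open>r - a\<close> keeps the triangle estimate strictly
        below \<open>r\<close>; the cap 1 keeps \<open>t\<close> in the range where both distances
        have the same balls.\<close>
      define t where "t = min 1 ((r - a) / 2)"
      have t: "0 < t" "t \<le> 1" "a + t < r" using a by (auto simp: t_def min_def field_simps)
      have "P.mball e t \<subseteq> {e \<in> continuous_pmets X. supD X d e < ennreal r}"
      proof
        fix f assume "f \<in> P.mball e t"
        then have f: "f \<in> continuous_pmets X" "supD X e f < ennreal t"
          using trunc_supD_less_iff t by auto
        have "supD X d f \<le> ennreal a + ennreal t"
          using supD_triangle[of X d f e] f(2) a(1) by (metis add_left_mono less_imp_le order_trans)
        also have "\<dots> = ennreal (a + t)" using a t by simp
        also have "\<dots> < ennreal r" using a t by (intro ennreal_lessI) auto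
        finally show "f \<in> {e \<in> continuous_pmets X. supD X d e < ennreal r}" using f by simp
      qed
      then show "\<exists>t>0. P.mball e t \<subseteq> {e \<in> continuous_pmets X. supD X d e < ennreal r}"
        using t by blast
    qed auto
    moreover have "B = {e \<in> continuous_pmets X. supD X d e < ennreal r} \<inter> Met X"
      using B sub by blast
    ultimately show "openin (subtopology P.mtopology (Met X)) B"
      by (auto simp: openin_subtopology)
  }
  fix U d assume "openin (subtopology P.mtopology (Met X)) U" and dU: "d \<in> U"
  then obtain T where T: "openin P.mtopology T" "U = T \<inter> Met X"
    by (auto simp: openin_subtopology)
  then obtain r where r: "r > 0" "P.mball d r \<subseteq> T"
    using dU unfolding P.openin_mtopology by blast
  define t where "t = min 1 r"
  have t: "0 < t" "t \<le> 1" "t \<le> r" using r by (auto simp: t_def)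
  have dM: "d \<in> Met X" using dU T by blast
  show "\<exists>B. (\<exists>d\<in>Met X. \<exists>r>0. B = {e \<in> Met X. supD X d e < ennreal r}) \<and> d \<in> B \<and> B \<subseteq> U"
  proof (intro exI conjI)
    show "\<exists>d'\<in>Met X. \<exists>r>0. {e \<in> Met X. supD X d e < ennreal t} = {e \<in> Met X. supD X d' e < ennreal r}"
      using dM t by blast
    show "d \<in> {e \<in> Met X. supD X d e < ennreal t}"
      using dM t by (simp add: supD_self)
    show "{e \<in> Met X. supD X d e < ennreal t} \<subseteq> U"
    proof
      fix e assume "e \<in> {e \<in> Met X. supD X d e < ennreal t}"
      then have "e \<in> Met X" "trunc_supD X d e < t"
        using t by (simp_all add: trunc_supD_less_iff)
      then have "e \<in> P.mball d r" using sub dM t by auto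
      then show "e \<in> U" using r T \<open>e \<in> Met X\<close> by blast
    qed
  qed
qed

text \<open>A Lebesgue number argument for two metrics of the same topology: finitely many
  \<open>d\<close>-balls of radius \<open>s x / 2\<close> cover \<open>K\<close>, while the balls of
  radius \<open>s x\<close> lie in \<open>\<rho>\<close>-balls of radius \<open>r / 2\<close>. A
  point at \<open>d\<close>-distance below \<open>c\<close> from a point of \<open>K\<close> thus
  shares such a \<open>\<rho>\<close>-ball with it, so their \<open>\<rho>\<close>-distance is below
  \<open>r\<close>.\<close>

lemma compactin_metric_separation:
  assumes d: "Metric_space (topspace X) d" "Metric_space.mtopology (topspace X) d = X"
    and \<rho>: "Metric_space (topspace X) \<rho>" "Metric_space.mtopology (topspace X) \<rho> = X"
    and K: "compactin X K" and r: "r > 0"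
  obtains c where "c > 0" "\<And>x y. x \<in> K \<Longrightarrow> y \<in> topspace X \<Longrightarrow> r \<le> \<rho> x y \<Longrightarrow> c \<le> d x y"
proof -
  interpret d: Metric_space "topspace X" d by fact
  interpret \<rho>: Metric_space "topspace X" \<rho> by fact
  have KX: "K \<subseteq> topspace X" using K by (rule compactin_subset_topspace)
  have "\<exists>s>0. d.mball x s \<subseteq> \<rho>.mball x (r / 2)" if "x \<in> topspace X" for x
  proof -
    have "openin d.mtopology (\<rho>.mball x (r / 2))"
      using \<rho>.openin_mball[of x "r / 2"] unfolding d(2) \<rho>(2) .
    then show ?thesis using that r d.openin_mtopology by auto
  qed
  then obtain s where s: "\<And>x. x \<in> topspace X \<Longrightarrow> s x > 0 \<and> d.mball x (s x) \<subseteq> \<rho>.mball x (r / 2)"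
    by metis
  have "\<exists>\<F>. finite \<F> \<and> \<F> \<subseteq> (\<lambda>x. d.mball x (s x / 2)) ` K \<and> K \<subseteq> \<Union>\<F>"
  proof (rule compactinD[OF K])
    show "openin X U" if U: "U \<in> (\<lambda>x. d.mball x (s x / 2)) ` K" for U
    proof -
      obtain x where "U = d.mball x (s x / 2)" using U by blast
      then show ?thesis using d.openin_mball[of x "s x / 2"] unfolding d(2) by simp
    qed
    show "K \<subseteq> \<Union>((\<lambda>x. d.mball x (s x / 2)) ` K)"
      using KX s by fastforce
  qed
  then obtain \<F> where \<F>: "finite \<F>" "\<F> \<subseteq> (\<lambda>x. d.mball x (s x / 2)) ` K" "K \<subseteq> \<Union>\<F>"
    by blast
  obtain F where "finite F" "F \<subseteq> K" "\<F> = (\<lambda>x. d.mball x (s x / 2)) ` F"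
    using finite_subset_image[OF \<F>(1,2)] by blast
  then have F: "finite F" "F \<subseteq> K" "K \<subseteq> (\<Union>x\<in>F. d.mball x (s x / 2))"
    using \<F>(3) by simp_all
  \<comment> \<open>The extra element 1 keeps the minimum over a nonempty set when \<open>K\<close>
    is empty.\<close>
  define c where "c = Min (insert 1 ((\<lambda>x. s x / 2) ` F))"
  have "c > 0" unfolding c_def using F KX s by (subst Min_gr_iff) auto
  moreover have "c \<le> d z y" if z: "z \<in> K" and y: "y \<in> topspace X" and ry: "r \<le> \<rho> z y" for z y
  proof (rule ccontr)
    assume "\<not> c \<le> d z y"
    obtain x where x: "x \<in> F" "z \<in> d.mball x (s x / 2)" using F z by blast
    then have "c \<le> s x / 2" unfolding c_def using F by (intro Min_le) auto
    then have "d x y < s x"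
      using \<open>\<not> c \<le> d z y\<close> x d.triangle[of x z y] y by auto
    then have "y \<in> \<rho>.mball x (r / 2)" "z \<in> \<rho>.mball x (r / 2)"
      using s[of x] x y d.nonneg[of x z] by (auto simp: subset_iff)
    then have "\<rho> z y < r"
      using \<rho>.triangle[of z x y] \<rho>.commute[of z x] by auto
    then show False using ry by simp
  qed
  ultimately show thesis by (rule that)
qed

lemma metrizable_space_metric:
  assumes "metrizable_space X"
  obtains d where "Metric_space (topspace X) d" "Metric_space.mtopology (topspace X) d = X"
proof -
  obtain M d where d: "Metric_space M d" "X = Metric_space.mtopology M d"
    using assms unfolding metrizable_space_def by blast
  then have "topspace X = M" by (simp add: Metric_space.topspace_mtopology)
  with d that show thesis by simp
qed

lemma sigma_compact_spaceE:
  assumes "sigma_compact_space X"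
  obtains \<C> where "countable \<C>" "\<forall>K\<in>\<C>. compactin X K" "\<Union>\<C> = topspace X"
proof -
  obtain \<C> where "countable \<C> \<and> (\<forall>K\<in>\<C>. compactin X K) \<and> \<Union>\<C> = topspace X"
    using assms unfolding sigma_compact_space_def by (rule exE)
  then show thesis by (intro that[of \<C>]) simp_all
qed

text \<open>A G-delta subset of a completely metrizable space is completely metrizable, so it
  suffices to write \<open>Met X\<close> as a countable intersection of open subsets of
  \<open>continuous_pmets X\<close>.\<close>

lemma completely_metrizable_Met_topology:
  assumes X: "metrizable_space X" and sc: "sigma_compact_space X"
  shows "completely_metrizable_space (Met_topology X)"
proof -
  interpret P: Metric_space "continuous_pmets X" "trunc_supD X"
    by (rule Metric_space_continuous_pmets)
  have H: "Hausdorff_space X" using X by (rule metrizable_imp_Hausdorff_space)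
  obtain \<rho> where \<rho>: "Metric_space (topspace X) \<rho>" "Metric_space.mtopology (topspace X) \<rho> = X"
    by (rule metrizable_space_metric[OF X])
  obtain \<C> where \<C>: "countable \<C>" "\<forall>K\<in>\<C>. compactin X K" "\<Union>\<C> = topspace X"
    by (rule sigma_compact_spaceE[OF sc])
  \<comment> \<open>This makes the condition of \<open>Met_eq\<close> uniform over \<open>K\<close>:
    the common bound \<open>c\<close> makes \<open>W K n\<close> open, and letting \<open>y\<close>
    run over the whole carrier controls neighbourhoods in \<open>X\<close> rather than in
    \<open>K\<close>. Metrics in \<open>Met X\<close> satisfy it by compactness.\<close>
  define W where "W K n = {d \<in> continuous_pmets X.
      \<exists>c>0. \<forall>x\<in>K. \<forall>y\<in>topspace X. 1 / real (Suc n) \<le> \<rho> x y \<longrightarrow> c \<le> d x y}" for K n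
  \<comment> \<open>Adding the whole space keeps the family nonempty, and its intersection inside
    \<open>continuous_pmets X\<close>, also when \<open>\<C>\<close> is empty.\<close>
  define \<W> where "\<W> = insert (continuous_pmets X) ((\<lambda>(K, n). W K n) ` (\<C> \<times> UNIV))"
  have W_open: "openin P.mtopology (W K n)" if "K \<in> \<C>" for K n
    unfolding P.openin_mtopology
  proof (intro conjI allI impI)
    fix d assume "d \<in> W K n"
    then obtain c where d: "d \<in> continuous_pmets X" and c: "c > 0"
      "\<forall>x\<in>K. \<forall>y\<in>topspace X. 1 / real (Suc n) \<le> \<rho> x y \<longrightarrow> c \<le> d x y"
      unfolding W_def by blast
    have "P.mball d (min 1 (c / 2)) \<subseteq> W K n"
    proof
      fix e assume e: "e \<in> P.mball d (min 1 (c / 2))"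
      have "c / 2 \<le> e x y" if "x \<in> K" "y \<in> topspace X" "1 / real (Suc n) \<le> \<rho> x y" for x y
      proof -
        have "x \<in> topspace X" using \<open>x \<in> K\<close> \<open>K \<in> \<C>\<close> \<C>(3) by blast
        then have "\<bar>d x y - e x y\<bar> < min 1 (c / 2)"
          using e that by (intro trunc_supD_lessD) auto
        moreover have "c \<le> d x y" using c that by blast
        ultimately show ?thesis by linarith
      qed
      then show "e \<in> W K n" using e c unfolding W_def by (auto intro!: exI[of _ "c / 2"])
    qed
    then show "\<exists>r>0. P.mball d r \<subseteq> W K n" using c by (intro exI[of _ "min 1 (c / 2)"]) auto
  qed (auto simp: W_def)
  have "Met X = \<Inter>\<W>"
  proof (intro equalityI subsetI)
    fix d assume d: "d \<in> Met X"
    then have "d \<in> continuous_pmets X" using Met_eq[OF H] by blast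
    moreover have "d \<in> W K n" if K: "K \<in> \<C>" for K n
    proof -
      have dm: "Metric_space (topspace X) d" "Metric_space.mtopology (topspace X) d = X"
        using d by (auto simp: Met_def)
      obtain c where "c > 0"
        "\<And>x y. x \<in> K \<Longrightarrow> y \<in> topspace X \<Longrightarrow> 1 / real (Suc n) \<le> \<rho> x y \<Longrightarrow> c \<le> d x y"
        using compactin_metric_separation[OF dm \<rho> bspec[OF \<C>(2) K], of "1 / real (Suc n)"] by auto
      then show ?thesis using \<open>d \<in> continuous_pmets X\<close> unfolding W_def by blast
    qed
    ultimately show "d \<in> \<Inter>\<W>" by (auto simp: \<W>_def)
  next
    fix d assume d: "d \<in> \<Inter>\<W>"
    then have dP: "d \<in> continuous_pmets X" and dW: "\<And>K n. K \<in> \<C> \<Longrightarrow> d \<in> W K n"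
      by (auto simp: \<W>_def)
    have "\<exists>\<epsilon>>0. \<forall>y\<in>topspace X. d x y < \<epsilon> \<longrightarrow> y \<in> U" if U: "openin X U" "x \<in> U" for U x
    proof -
      have x: "x \<in> topspace X" using U openin_subset by blast
      obtain K where K: "K \<in> \<C>" "x \<in> K" using x \<C>(3) by blast
      obtain r where r: "r > 0" "\<forall>y\<in>topspace X. \<rho> x y < r \<longrightarrow> y \<in> U"
        using conjunct2[OF iffD1[OF mtopology_eq_iff[OF \<rho>(1)] \<rho>(2)], rule_format, OF conjI[OF U]]
        by blast
      obtain n where n: "1 / real (Suc n) < r"
        using nat_approx_posE[OF r(1)] by metis
      obtain c where "c > 0" "\<forall>y\<in>topspace X. 1 / real (Suc n) \<le> \<rho> x y \<longrightarrow> c \<le> d x y"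
        using dW[OF K(1), of n] K(2) unfolding W_def by blast
      \<comment> \<open>The witness works because \<open>d x y < c\<close> forces
        \<open>\<rho> x y < 1 / real (Suc n) < r\<close>, hence \<open>y \<in> U\<close>.\<close>
      then show ?thesis using r n by (intro exI[of _ c]) force
    qed
    then show "d \<in> Met X" unfolding Met_eq[OF H] using dP by blast
  qed
  moreover have "gdelta_in P.mtopology (\<Inter>\<W>)"
  proof (rule gdelta_in_Inter)
    show "countable \<W>" unfolding \<W>_def using \<C>(1) by auto
    show "\<W> \<noteq> {}" by (simp add: \<W>_def)
    show "gdelta_in P.mtopology S" if "S \<in> \<W>" for S
    proof (rule open_imp_gdelta_in)
      show "openin P.mtopology S"
        using that W_open openin_topspace[of P.mtopology] by (auto simp: \<W>_def)
    qed
  qed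
  ultimately have "gdelta_in P.mtopology (Met X)" by simp
  moreover have "completely_metrizable_space P.mtopology"
    unfolding completely_metrizable_space_def
    using P.Metric_space_axioms mcomplete_continuous_pmets by blast
  ultimately show ?thesis
    unfolding Met_topology_eq[OF H] by (intro completely_metrizable_space_gdelta_in)
qed

section \<open>Clopen partitions\<close>

lemma sigma_compact_imp_Lindelof:
  assumes "sigma_compact_space X"
  shows "Lindelof_space X"
proof -
  obtain \<C> where \<C>: "countable \<C>" "\<forall>K\<in>\<C>. compactin X K" "\<Union>\<C> = topspace X"
    by (rule sigma_compact_spaceE[OF assms])
  have "Lindelof_space (subtopology X (\<Union>\<C>))"
  proof (rule Lindelof_space_Union[OF \<C>(1)])
    show "Lindelof_space (subtopology X K)" if "K \<in> \<C>" for K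
      using \<C>(2) that by (intro compact_imp_Lindelof_space compact_space_subtopology) simp
  qed
  then show ?thesis using \<C>(3) by simp
qed

text \<open>Each point has a clopen neighbourhood inside its ball of radius
  \<open>\<eta> / 2\<close>; the Lindelof property leaves countably many of these, and removing from
  each the finitely many earlier ones makes them disjoint while keeping them open. Pieces may be
  empty; \<open>q\<close> sends a point to the index of its piece.\<close>

lemma clopen_partition:
  assumes zd: "strongly_zero_dimensional X" and L: "Lindelof_space X"
    and d: "Metric_space (topspace X) d" "Metric_space.mtopology (topspace X) d = X"
    and \<eta>: "\<eta> > 0"
  obtains q :: "'a \<Rightarrow> nat" where
    "\<And>n. openin X {x \<in> topspace X. q x = n}"
    "\<And>x y. x \<in> topspace X \<Longrightarrow> y \<in> topspace X \<Longrightarrow> q x = q y \<Longrightarrow> d x y < \<eta>"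
\<comment> \<open>The empty carrier is treated apart because \<open>from_nat_into\<close> below has
  to enumerate a nonempty cover.\<close>
proof (cases "topspace X = {}")
  case True
  show thesis by (rule that[of "\<lambda>_. 0"]) (use True in auto)
next
  case False
  interpret d: Metric_space "topspace X" d by fact
  have op: "openin X (d.mball x r)" for x r
    using d.openin_mball[of x r] unfolding d(2) .
  have "\<exists>V. closedin X V \<and> openin X V \<and> x \<in> V \<and> V \<subseteq> d.mball x (\<eta> / 2)"
    if x: "x \<in> topspace X" for x
  proof -
    have "closedin X {x}"
      using closedin_Hausdorff_singleton[OF d.Hausdorff_space_mtopology] x unfolding d(2) by simp
    moreover have "closedin X (topspace X - d.mball x (\<eta> / 2))"
      using op by (simp add: closedin_diff)
    moreover have "{x} \<inter> (topspace X - d.mball x (\<eta> / 2)) = {}" using \<eta> x by auto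
    ultimately obtain V where "closedin X V" "openin X V" "{x} \<subseteq> V"
      "V \<inter> (topspace X - d.mball x (\<eta> / 2)) = {}"
      using zd unfolding strongly_zero_dimensional_def by meson
    moreover have "V \<subseteq> topspace X" using \<open>openin X V\<close> by (rule openin_subset)
    ultimately show ?thesis by blast
  qed
  then obtain V where V: "\<And>x. x \<in> topspace X \<Longrightarrow>
      closedin X (V x) \<and> openin X (V x) \<and> x \<in> V x \<and> V x \<subseteq> d.mball x (\<eta> / 2)"
    by metis
  have "\<exists>\<V>. countable \<V> \<and> \<V> \<subseteq> V ` topspace X \<and> \<Union>\<V> = topspace X"
  proof (rule Lindelof_spaceD[OF L])
    show "openin X U" if "U \<in> V ` topspace X" for U using that V by auto
    show "\<Union>(V ` topspace X) = topspace X"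
      using V openin_subset[of X] by (intro equalityI UN_least) auto
  qed
  then obtain \<V> where \<V>: "countable \<V>" "\<V> \<subseteq> V ` topspace X" "\<Union>\<V> = topspace X"
    by (elim exE conjE) (rule that)
  have "\<V> \<noteq> {}"
  proof
    assume "\<V> = {}"
    then have "topspace X = {}" unfolding \<V>(3)[symmetric] by simp
    with False show False by contradiction
  qed
  define B where "B = from_nat_into \<V>"
  have "range B = \<V>"
    unfolding B_def using \<open>\<V> \<noteq> {}\<close> \<V>(1) by (rule range_from_nat_into)
  then have UB: "(\<Union>n. B n) = topspace X" using \<V>(3) by simp
  have B: "\<exists>x\<in>topspace X. B n = V x" for n
  proof -
    have "B n \<in> V ` topspace X" using \<open>range B = \<V>\<close> \<V>(2) by auto
    then show ?thesis by auto
  qed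
  define q where "q x = (LEAST n. x \<in> B n)" for x
  have q: "x \<in> B (q x)" if "x \<in> topspace X" for x
  proof -
    have "\<exists>n. x \<in> B n" using that UB by (metis UN_iff)
    then show ?thesis unfolding q_def by (rule LeastI_ex)
  qed
  show thesis
  proof (rule that)
    fix n
    have "{x \<in> topspace X. q x = n} = B n - (\<Union>i<n. B i)"
    proof (intro equalityI subsetI)
      fix x assume "x \<in> {x \<in> topspace X. q x = n}"
      then have x: "x \<in> topspace X" "q x = n" by auto
      have "x \<notin> B i" if "i < n" for i
        using not_less_Least[of i "\<lambda>n. x \<in> B n"] that x(2) unfolding q_def by simp
      then show "x \<in> B n - (\<Union>i<n. B i)" using q[OF x(1)] x(2) by auto
    next
      fix x assume x: "x \<in> B n - (\<Union>i<n. B i)"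
      then have "q x = n" unfolding q_def by (intro Least_equality) (auto simp: not_less[symmetric])
      moreover have "x \<in> topspace X" using x UN_upper[of n UNIV B] unfolding UB by auto
      ultimately show "x \<in> {x \<in> topspace X. q x = n}" by simp
    qed
    moreover have "openin X (B n - (\<Union>i<n. B i))"
    proof (intro openin_diff closedin_Union)
      show "openin X (B n)" using B[of n] V by auto
      show "closedin X T" if T: "T \<in> B ` {..<n}" for T
      proof -
        obtain i where "T = B i" using T by auto
        then show ?thesis using B[of i] V by auto
      qed
    qed auto
    ultimately show "openin X {x \<in> topspace X. q x = n}" by simp
  next
    fix x y assume xy: "x \<in> topspace X" "y \<in> topspace X" "q x = q y"
    obtain z where z: "z \<in> topspace X" "B (q x) = V z" using B by blast
    then have "x \<in> d.mball z (\<eta> / 2)" "y \<in> d.mball z (\<eta> / 2)"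
      using q[OF xy(1)] q[OF xy(2)] V[OF z(1)] xy by auto
    then show "d x y < \<eta>" using d.triangle[of x z y] d.commute[of x z] by auto
  qed
qed

section \<open>Flattening a metric to pairwise distinct block constants\<close>

text \<open>The values are chosen by recursion: each interval is infinite, and only finitely many
  values are taken before stage \<open>k\<close>.\<close>

lemma distinct_real_choice:
  fixes b :: "nat \<Rightarrow> real"
  assumes "\<eta> > 0"
  obtains f where "inj f" "\<And>k. b k < f k \<and> f k < b k + \<eta>"
proof -
  have "\<exists>f. \<forall>k. b k < f k \<and> f k < b k + \<eta> \<and> f k \<notin> f ` {..<k}"
  proof (rule dependent_wf_choice[OF wf_less])
    fix f g :: "nat \<Rightarrow> real" and k r
    assume "\<And>z. (z, k) \<in> {(x, y). x < y} \<Longrightarrow> f z = g z"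
    then have "f ` {..<k} = g ` {..<k}" by (intro image_cong) auto
    then show "(b k < r \<and> r < b k + \<eta> \<and> r \<notin> f ` {..<k}) =
      (b k < r \<and> r < b k + \<eta> \<and> r \<notin> g ` {..<k})" by simp
  next
    fix k and f :: "nat \<Rightarrow> real"
    have "infinite ({b k<..<b k + \<eta>} - f ` {..<k})"
      using assms by (intro Diff_infinite_finite) auto
    then have "{b k<..<b k + \<eta>} - f ` {..<k} \<noteq> {}" by (metis finite.emptyI)
    then show "\<exists>r. b k < r \<and> r < b k + \<eta> \<and> r \<notin> f ` {..<k}" by auto
  qed
  then obtain f where f: "\<And>k. b k < f k \<and> f k < b k + \<eta> \<and> f k \<notin> f ` {..<k}" by blast
  moreover have "inj f"
    by (rule linorder_injI) (metis f image_eqI lessThan_iff)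
  ultimately show thesis using that by blast
qed

text \<open>Indexing the choice by the code of \<open>(min i j, max i j)\<close> yields one value
  per unordered pair, diagonal pairs included; injectivity of \<open>f\<close> recovers the
  pair.\<close>

lemma distinct_symmetric_real_choice:
  fixes a :: "nat \<Rightarrow> nat \<Rightarrow> real"
  assumes \<eta>: "\<eta> > 0" and a: "\<And>i j. a i j = a j i"
  obtains h where "\<And>i j. a i j < h i j \<and> h i j < a i j + \<eta>"
    "\<And>i j. h i j = h j i" "\<And>i j k l. h i j = h k l \<Longrightarrow> {i, j} = {k, l}"
proof -
  obtain f where f: "inj f" "\<And>k. case_prod a (prod_decode k) < f k \<and> f k < case_prod a (prod_decode k) + \<eta>"
    using distinct_real_choice[OF \<eta>, of "\<lambda>k. case_prod a (prod_decode k)"] by blast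
  define h where "h i j = f (prod_encode (min i j, max i j))" for i j
  have "a i j < h i j \<and> h i j < a i j + \<eta>" for i j
    using f(2)[of "prod_encode (min i j, max i j)"] a[of i j]
    by (cases "i \<le> j") (auto simp: h_def min_def max_def)
  moreover have "h i j = h j i" for i j by (simp add: h_def min.commute max.commute)
  moreover have "{i, j} = {k, l}" if "h i j = h k l" for i j k l
  proof -
    have "min i j = min k l \<and> max i j = max k l"
      using that f(1) by (auto simp: h_def inj_eq)
    then show ?thesis by (auto simp: min_def max_def split: if_splits)
  qed
  ultimately show thesis by (rule that)
qed

text \<open>Flattening \<open>d\<close> to constants on the off-diagonal blocks of a partition into pieces of
  diameter less than \<open>\<eta>\<close>. Since all constants lie between \<open>d (p i) (p j) + \<eta>\<close> and
  \<open>d (p i) (p j) + 2 \<eta>\<close>, the triangle inequality survives every choice of them.\<close>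

lemma Met_block_constant:
  fixes q :: "'a \<Rightarrow> nat" and p :: "nat \<Rightarrow> 'a"
  assumes H: "Hausdorff_space X" and d: "d \<in> Met X" and \<eta>: "\<eta> > 0"
    and q: "\<And>n. openin X {x \<in> topspace X. q x = n}"
      "\<And>x y. x \<in> topspace X \<Longrightarrow> y \<in> topspace X \<Longrightarrow> q x = q y \<Longrightarrow> d x y < \<eta>"
    and p: "\<And>x. x \<in> topspace X \<Longrightarrow> p (q x) \<in> topspace X \<and> q (p (q x)) = q x"
    and h: "\<And>i j. d (p i) (p j) + \<eta> < h i j \<and> h i j < d (p i) (p j) + 2 * \<eta>"
      "\<And>i j. h i j = h j i"
  defines "e \<equiv> \<lambda>x y. if x \<in> topspace X \<and> y \<in> topspace X \<and> q x \<noteq> q y then h (q x) (q y) else d x y"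
  shows "e \<in> Met X" "\<And>x y. \<bar>d x y - e x y\<bar> \<le> 4 * \<eta>"
proof -
  have dP: "d \<in> continuous_pmets X" and dB: "\<And>U x. openin X U \<Longrightarrow> x \<in> U \<Longrightarrow>
      \<exists>\<epsilon>>0. \<forall>y\<in>topspace X. d x y < \<epsilon> \<longrightarrow> y \<in> U"
    using d Met_eq[OF H] by auto
  note D = continuous_pmetsD[OF dP]
  have nn: "0 \<le> d x y" for x y by (rule continuous_pmets_nonneg[OF dP])
  have h\<eta>: "\<eta> < h i j" for i j using h(1)[of i j] nn[of "p i" "p j"] by linarith
  \<comment> \<open>The chain is \<open>h i k < d (p i) (p k) + 2 * \<eta> \<le> d (p i) (p j) + d
    (p j) (p k) + 2 * \<eta> < h i j + h j k\<close>: two lower margins \<open>\<eta>\<close> add up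
    to the upper margin.\<close>
  have hh: "h i k \<le> h i j + h j k" if "p i \<in> topspace X" "p j \<in> topspace X" "p k \<in> topspace X" for i j k
    using h(1)[of i k] h(1)[of i j] h(1)[of j k] D(3)[OF that] by linarith
  have "e \<in> continuous_pmets X"
    unfolding continuous_pmets_def mem_Collect_eq
  proof (intro conjI ballI allI impI)
    fix x y z assume x: "x \<in> topspace X"
    show "e x x = 0" by (simp add: e_def D(1) x)
    assume y: "y \<in> topspace X"
    show "e x y = e y x" by (auto simp: e_def h(2) D(2)[of x y])
    assume z: "z \<in> topspace X"
    consider "q x = q y" "q y = q z" | "q x = q y" "q y \<noteq> q z" | "q x \<noteq> q y" "q y = q z"
      | "q x \<noteq> q y" "q y \<noteq> q z" "q x = q z" | "q x \<noteq> q y" "q y \<noteq> q z" "q x \<noteq> q z"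
      by metis
    then show "e x z \<le> e x y + e y z"
    proof cases
      case 1
      then show ?thesis using D(3)[OF x y z] by (simp add: e_def)
    next
      case 2
      then show ?thesis using x y z nn[of x y] by (simp add: e_def)
    next
      case 3
      then show ?thesis using x y z nn[of y z] by (simp add: e_def)
    next
      case 4
      \<comment> \<open>Only the endpoints share a piece: their distance is below
        \<open>\<eta>\<close>, and each constant on the detour exceeds
        \<open>\<eta>\<close>.\<close>
      then show ?thesis
        using x y z q(2)[OF x z] h\<eta>[of "q x" "q y"] h\<eta>[of "q y" "q z"] \<eta> by (simp add: e_def)
    next
      case 5
      then show ?thesis
        using x y z hh[of "q x" "q y" "q z"] p by (simp add: e_def)
    qed
  next
    fix x and \<epsilon> :: real assume x: "x \<in> topspace X" and \<epsilon>: "\<epsilon> > 0"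
    obtain U where U: "openin X U" "x \<in> U" "\<forall>y\<in>U. d x y < \<epsilon>" using D(4)[OF x \<epsilon>] by auto
    show "\<exists>U. openin X U \<and> x \<in> U \<and> (\<forall>y\<in>U. e x y < \<epsilon>)"
    proof (intro exI conjI)
      \<comment> \<open>Inside the open piece of \<open>x\<close>, distances from \<open>x\<close>
        under \<open>e\<close> and \<open>d\<close> agree.\<close>
      show "openin X (U \<inter> {y \<in> topspace X. q y = q x})" by (intro openin_Int U(1) q(1))
    qed (use x U in \<open>auto simp: e_def\<close>)
  next
    fix x y assume "x \<notin> topspace X \<or> y \<notin> topspace X"
    then show "e x y = 0" using D(5) by (auto simp: e_def)
  qed
  moreover have "\<exists>\<epsilon>>0. \<forall>y\<in>topspace X. e x y < \<epsilon> \<longrightarrow> y \<in> U" if U: "openin X U \<and> x \<in> U" for U x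
  proof -
    obtain \<epsilon> where \<epsilon>: "\<epsilon> > 0" "\<forall>y\<in>topspace X. d x y < \<epsilon> \<longrightarrow> y \<in> U" using dB[of U x] U by auto
    \<comment> \<open>Distances between different pieces exceed \<open>\<eta>\<close>, so a smaller
      value of \<open>e\<close> forces a common piece, where \<open>e\<close> is
      \<open>d\<close>.\<close>
    have "y \<in> U" if "y \<in> topspace X" "e x y < min \<epsilon> \<eta>" for y
      using that \<epsilon> h\<eta>[of "q x" "q y"] by (auto simp: e_def split: if_splits)
    then show ?thesis using \<epsilon>(1) \<eta> by (intro exI[of _ "min \<epsilon> \<eta>"]) auto
  qed
  ultimately show "e \<in> Met X" unfolding Met_eq[OF H] by simp
  show "\<bar>d x y - e x y\<bar> \<le> 4 * \<eta>" for x y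
  proof (cases "x \<in> topspace X \<and> y \<in> topspace X \<and> q x \<noteq> q y")
    case True
    let ?x = "p (q x)" and ?y = "p (q y)"
    have X: "x \<in> topspace X" "y \<in> topspace X" "?x \<in> topspace X" "?y \<in> topspace X"
      using True p by auto
    \<comment> \<open>Moving both points to their representatives changes \<open>d\<close> by less
      than \<open>2 * \<eta>\<close>, and the constant adds less than \<open>2 * \<eta>\<close>
      more; hence the bound \<open>4 * \<eta>\<close>.\<close>
    have "d x ?x < \<eta>" "d y ?y < \<eta>" using q(2) X p by auto
    moreover have "d x y \<le> d x ?x + (d ?x ?y + d ?y y)"
      using D(3)[of x ?x y] D(3)[of ?x ?y y] X by linarith
    moreover have "d ?x ?y \<le> d ?x x + (d x y + d y ?y)"
      using D(3)[of ?x x ?y] D(3)[of x y ?y] X by linarith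
    ultimately show ?thesis
      using True h(1)[of "q x" "q y"] D(2)[of x ?x] D(2)[of y ?y] by (simp add: e_def) linarith
  next
    case False
    then show ?thesis using \<eta> by (auto simp: e_def)
  qed
qed

section \<open>Genericity on compact sets\<close>

text \<open>A quantitative form of genericity on \<open>K\<close>. The point \<open>u\<close> stays
  away from \<open>x\<close> and \<open>y\<close>, whereas \<open>v\<close> is arbitrary and may
  coincide with any of them. Separation of points is measured by a fixed \<open>\<rho>\<close>, so
  that the constraint does not move with \<open>d\<close>; the uniform \<open>\<delta>\<close> makes
  the set open.\<close>

definition gap_metrics :: "'a topology \<Rightarrow> ('a \<Rightarrow> 'a \<Rightarrow> real) \<Rightarrow> 'a set \<Rightarrow> real \<Rightarrow> ('a \<Rightarrow> 'a \<Rightarrow> real) set" where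
  "gap_metrics X \<rho> K r = {d \<in> Met X. \<exists>\<delta>>0. \<forall>x\<in>K. \<forall>y\<in>K. \<forall>u\<in>K. \<forall>v\<in>K.
     r \<le> \<rho> x y \<and> r \<le> \<rho> x u \<and> r \<le> \<rho> y u \<longrightarrow> \<delta> \<le> \<bar>d x y - d u v\<bar>}"

lemma openin_gap_metrics:
  assumes "Hausdorff_space X" "K \<subseteq> topspace X"
  shows "openin (Met_topology X) (gap_metrics X \<rho> K r)"
proof -
  interpret P: Metric_space "continuous_pmets X" "trunc_supD X"
    by (rule Metric_space_continuous_pmets)
  have sub: "Met X \<subseteq> continuous_pmets X" using Met_eq[OF assms(1)] by auto
  have "\<exists>s>0. Met X \<inter> P.mball d s \<subseteq> gap_metrics X \<rho> K r" if d: "d \<in> gap_metrics X \<rho> K r" for d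
  proof -
    obtain \<delta> where \<delta>: "\<delta> > 0" "\<And>x y u v. x \<in> K \<Longrightarrow> y \<in> K \<Longrightarrow> u \<in> K \<Longrightarrow> v \<in> K \<Longrightarrow>
        r \<le> \<rho> x y \<and> r \<le> \<rho> x u \<and> r \<le> \<rho> y u \<Longrightarrow> \<delta> \<le> \<bar>d x y - d u v\<bar>"
      using d unfolding gap_metrics_def by blast
    \<comment> \<open>Each of the two distances moves by less than \<open>\<delta> / 4\<close>, so a
      gap of \<open>\<delta> / 2\<close> remains.\<close>
    have "e \<in> gap_metrics X \<rho> K r" if e: "e \<in> Met X" "e \<in> P.mball d (min 1 (\<delta> / 4))" for e
    proof -
      have close: "\<bar>d x y - e x y\<bar> < \<delta> / 4" if "x \<in> K" "y \<in> K" for x y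
        using trunc_supD_lessD[of X d e "min 1 (\<delta> / 4)" x y] e that assms(2) by auto
      have "\<delta> / 2 \<le> \<bar>e x y - e u v\<bar>" if "x \<in> K" "y \<in> K" "u \<in> K" "v \<in> K"
        "r \<le> \<rho> x y \<and> r \<le> \<rho> x u \<and> r \<le> \<rho> y u" for x y u v
        using \<delta>(2)[OF that] close[OF that(1,2)] close[OF that(3,4)] by linarith
      then show ?thesis unfolding gap_metrics_def using e(1) \<delta>(1)
        by (intro CollectI conjI exI[of _ "\<delta> / 2"]) auto
    qed
    then show ?thesis using \<delta>(1) by (intro exI[of _ "min 1 (\<delta> / 4)"]) auto
  qed
  then obtain s where s: "\<And>d. d \<in> gap_metrics X \<rho> K r \<Longrightarrow> s d > 0 \<and> Met X \<inter> P.mball d (s d) \<subseteq> gap_metrics X \<rho> K r"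
    by metis
  have G: "gap_metrics X \<rho> K r \<subseteq> Met X" unfolding gap_metrics_def by auto
  have "gap_metrics X \<rho> K r = (\<Union>d\<in>gap_metrics X \<rho> K r. P.mball d (s d)) \<inter> Met X"
  proof (intro equalityI subsetI)
    fix d assume d: "d \<in> gap_metrics X \<rho> K r"
    then have "d \<in> P.mball d (s d)" using s[OF d] G sub by auto
    then show "d \<in> (\<Union>d\<in>gap_metrics X \<rho> K r. P.mball d (s d)) \<inter> Met X" using d G by blast
  qed (use s in blast)
  then show ?thesis
    unfolding Met_topology_eq[OF assms(1)] openin_subtopology
    by (intro exI[of _ "\<Union>d\<in>gap_metrics X \<rho> K r. P.mball d (s d)"]) auto
qed

text \<open>The pieces are pairwise disjoint, so a finite subcover of \<open>K\<close> has to
  contain every piece that \<open>K\<close> meets.\<close>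

lemma finite_partition_of_compact:
  fixes q :: "'a \<Rightarrow> nat"
  assumes K: "compactin X K" and q: "\<And>n. openin X {x \<in> topspace X. q x = n}"
  shows "finite (q ` K)"
proof -
  have KX: "K \<subseteq> topspace X" using K by (rule compactin_subset_topspace)
  have "\<exists>\<F>. finite \<F> \<and> \<F> \<subseteq> range (\<lambda>n. {x \<in> topspace X. q x = n}) \<and> K \<subseteq> \<Union>\<F>"
  proof (rule compactinD[OF K])
    show "openin X U" if "U \<in> range (\<lambda>n. {x \<in> topspace X. q x = n})" for U
      using that q by auto
    show "K \<subseteq> \<Union>(range (\<lambda>n. {x \<in> topspace X. q x = n}))" using KX by auto
  qed
  then obtain \<F> where \<F>: "finite \<F>" "\<F> \<subseteq> range (\<lambda>n. {x \<in> topspace X. q x = n})" "K \<subseteq> \<Union>\<F>"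
    by auto
  obtain N where N: "finite N" "\<F> = (\<lambda>n. {x \<in> topspace X. q x = n}) ` N"
    using finite_subset_image[OF \<F>(1,2)] by blast
  have "q ` K \<subseteq> N" using \<F>(3) N(2) by auto
  then show ?thesis using N(1) finite_subset by blast
qed

lemma finite_separation:
  fixes A :: "real set"
  assumes "finite A"
  obtains \<delta> where "\<delta> > 0" "\<And>a b. a \<in> A \<Longrightarrow> b \<in> A \<Longrightarrow> a \<noteq> b \<Longrightarrow> \<delta> \<le> \<bar>a - b\<bar>"
proof -
  \<comment> \<open>Removing 0 makes the minimum positive; 1 is inserted below in case no
    differences remain.\<close>
  define T where "T = (\<lambda>(a, b). \<bar>a - b\<bar>) ` (A \<times> A) - {0}"
  have T: "finite T" using assms unfolding T_def by simp
  have "0 < Min (insert 1 T)" using T by (auto simp: T_def)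
  moreover have "Min (insert 1 T) \<le> \<bar>a - b\<bar>" if "a \<in> A" "b \<in> A" "a \<noteq> b" for a b
    using T that by (intro Min_le) (auto simp: T_def)
  ultimately show thesis by (rule that)
qed

lemma gap_metrics_dense:
  assumes X: "metrizable_space X" and zd: "strongly_zero_dimensional X" and L: "Lindelof_space X"
    and \<rho>: "Metric_space (topspace X) \<rho>" "Metric_space.mtopology (topspace X) \<rho> = X"
    and K: "compactin X K" and r: "r > 0" and d: "d \<in> Met X" and \<epsilon>: "\<epsilon> > 0"
  obtains e where "e \<in> gap_metrics X \<rho> K r" "\<And>x y. \<bar>d x y - e x y\<bar> \<le> \<epsilon>"
proof -
  have H: "Hausdorff_space X" using X by (rule metrizable_imp_Hausdorff_space)
  have KX: "K \<subseteq> topspace X" using K by (rule compactin_subset_topspace)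
  have dm: "Metric_space (topspace X) d" "Metric_space.mtopology (topspace X) d = X"
    using d by (auto simp: Met_def)
  have dP: "d \<in> continuous_pmets X" using d Met_eq[OF H] by auto
  obtain c where c: "c > 0" "\<And>x y. x \<in> K \<Longrightarrow> y \<in> topspace X \<Longrightarrow> r \<le> \<rho> x y \<Longrightarrow> c \<le> d x y"
    using compactin_metric_separation[OF dm \<rho> K r] by metis
  \<comment> \<open>\<open>\<eta> \<le> c\<close> puts points of \<open>K\<close> at
    \<open>\<rho>\<close>-distance at least \<open>r\<close> into different pieces;
    \<open>4 * \<eta> \<le> \<epsilon>\<close> absorbs the error of
    \<open>Met_block_constant\<close>.\<close>
  define \<eta> where "\<eta> = min c (\<epsilon> / 4)"
  have \<eta>: "\<eta> > 0" "\<eta> \<le> c" "4 * \<eta> \<le> \<epsilon>" using c \<epsilon> by (auto simp: \<eta>_def)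
  obtain q :: "'a \<Rightarrow> nat" where q: "\<And>n. openin X {x \<in> topspace X. q x = n}"
      "\<And>x y. x \<in> topspace X \<Longrightarrow> y \<in> topspace X \<Longrightarrow> q x = q y \<Longrightarrow> d x y < \<eta>"
    using clopen_partition[OF zd L dm \<eta>(1)] by metis
  \<comment> \<open>For an empty piece \<open>p n\<close> is an unspecified element, possibly off
    the carrier, where \<open>d\<close> is 0; the bounds on \<open>h\<close> thus make sense for all
    indices.\<close>
  define p where "p n = (SOME x. x \<in> topspace X \<and> q x = n)" for n
  have p: "p (q x) \<in> topspace X \<and> q (p (q x)) = q x" if "x \<in> topspace X" for x
    unfolding p_def by (rule someI[of _ x]) (simp add: that)
  obtain h where h: "\<And>i j. d (p i) (p j) + \<eta> < h i j \<and> h i j < d (p i) (p j) + \<eta> + \<eta>"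
    "\<And>i j. h i j = h j i" "\<And>i j k l. h i j = h k l \<Longrightarrow> {i, j} = {k, l}"
    using distinct_symmetric_real_choice[OF \<eta>(1), of "\<lambda>i j. d (p i) (p j) + \<eta>"]
      continuous_pmetsD(2)[OF dP] by metis
  have h': "d (p i) (p j) + \<eta> < h i j \<and> h i j < d (p i) (p j) + 2 * \<eta>" for i j
    using h(1)[of i j] by simp
  define e where "e = (\<lambda>x y. if x \<in> topspace X \<and> y \<in> topspace X \<and> q x \<noteq> q y
    then h (q x) (q y) else d x y)"
  have e: "e \<in> Met X" "\<bar>d x y - e x y\<bar> \<le> 4 * \<eta>" for x y
    using Met_block_constant[OF H d \<eta>(1) q p h' h(2)] unfolding e_def by blast+
  \<comment> \<open>\<open>\<eta>\<close> is added as a threshold: distances within one piece lie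
    below it and block constants above it, so the gap between \<open>\<eta>\<close> and the
    constants also separates these two kinds of values.\<close>
  define A where "A = insert \<eta> ((\<lambda>(i, j). h i j) ` (q ` K \<times> q ` K))"
  have "finite A" unfolding A_def using finite_partition_of_compact[OF K q(1)] by simp
  then obtain \<delta> where \<delta>: "\<delta> > 0" "\<And>a b. a \<in> A \<Longrightarrow> b \<in> A \<Longrightarrow> a \<noteq> b \<Longrightarrow> \<delta> \<le> \<bar>a - b\<bar>"
    by (rule finite_separation) blast
  have h\<eta>: "\<eta> < h i j" for i j
    using h(1)[of i j] continuous_pmets_nonneg[OF dP, of "p i" "p j"] by linarith
  have qne: "q x \<noteq> q y" if "x \<in> K" "y \<in> K" "r \<le> \<rho> x y" for x y
    using c(2)[of x y] q(2)[of x y] \<eta>(2) that KX by force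
  have "\<delta> \<le> \<bar>e x y - e u v\<bar>" if K: "x \<in> K" "y \<in> K" "u \<in> K" "v \<in> K"
      and ge: "r \<le> \<rho> x y \<and> r \<le> \<rho> x u \<and> r \<le> \<rho> y u" for x y u v
  proof -
    have X: "x \<in> topspace X" "y \<in> topspace X" "u \<in> topspace X" "v \<in> topspace X"
      using K KX by auto
    have ne: "q x \<noteq> q y" "q x \<noteq> q u" "q y \<noteq> q u" using qne K ge by auto
    have exy: "e x y = h (q x) (q y)" using X ne by (simp add: e_def)
    have hA: "h (q x) (q y) \<in> A" using K by (auto simp: A_def)
    show ?thesis
    proof (cases "q u = q v")
      case True
      have "e u v < \<eta>" using q(2)[OF X(3,4) True] True by (simp add: e_def)
      moreover have "\<delta> \<le> \<bar>h (q x) (q y) - \<eta>\<bar>"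
        using hA h\<eta>[of "q x" "q y"] by (intro \<delta>(2)) (auto simp: A_def)
      ultimately show ?thesis using exy h\<eta>[of "q x" "q y"] by linarith
    next
      case False
      then have "e u v = h (q u) (q v)" using X by (simp add: e_def)
      \<comment> \<open>\<open>q u\<close> differs from \<open>q x\<close> and \<open>q y\<close>,
        so the unordered pairs of indices differ, whatever \<open>v\<close> is.\<close>
      moreover have "h (q x) (q y) \<noteq> h (q u) (q v)"
        using h(3)[of "q x" "q y" "q u" "q v"] ne by (auto simp: doubleton_eq_iff)
      moreover have "h (q u) (q v) \<in> A" using K by (auto simp: A_def)
      ultimately show ?thesis using exy hA \<delta>(2) by simp
    qed
  qed
  then have "e \<in> gap_metrics X \<rho> K r"
    unfolding gap_metrics_def using e(1) \<delta>(1) by blast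
  then show thesis using order_trans[OF e(2) \<eta>(3)] by (rule that)
qed


lemma closure_of_gap_metrics:
  assumes X: "metrizable_space X" and zd: "strongly_zero_dimensional X" and L: "Lindelof_space X"
    and \<rho>: "Metric_space (topspace X) \<rho>" "Metric_space.mtopology (topspace X) \<rho> = X"
    and K: "compactin X K" and r: "r > 0"
  shows "Met_topology X closure_of gap_metrics X \<rho> K r = topspace (Met_topology X)"
proof (intro equalityI closure_of_subset_topspace subsetI)
  interpret P: Metric_space "continuous_pmets X" "trunc_supD X"
    by (rule Metric_space_continuous_pmets)
  have H: "Hausdorff_space X" using X by (rule metrizable_imp_Hausdorff_space)
  have sub: "Met X \<subseteq> continuous_pmets X" using Met_eq[OF H] by auto
  fix d assume d: "d \<in> topspace (Met_topology X)"
  then have dM: "d \<in> Met X" unfolding Met_topology_eq[OF H] by simp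
  show "d \<in> Met_topology X closure_of gap_metrics X \<rho> K r"
    unfolding in_closure_of
  proof (intro conjI d allI impI)
    fix T assume "d \<in> T \<and> openin (Met_topology X) T"
    then obtain T' where T': "openin P.mtopology T'" "T = T' \<inter> Met X" "d \<in> T'"
      unfolding Met_topology_eq[OF H] openin_subtopology by auto
    then obtain s where s: "s > 0" "P.mball d s \<subseteq> T'"
      unfolding P.openin_mtopology by blast
    obtain e where e: "e \<in> gap_metrics X \<rho> K r" "\<And>x y. \<bar>d x y - e x y\<bar> \<le> s / 2"
      using gap_metrics_dense[OF X zd L \<rho> K r dM, of "s / 2"] s(1) by auto
    have eM: "e \<in> Met X" using e(1) by (simp add: gap_metrics_def)
    have "trunc_supD X d e \<le> s / 2" using e(2) s(1) by (intro trunc_supD_leI) auto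
    then have "e \<in> P.mball d s" using s(1) dM eM sub by auto
    then show "\<exists>e. e \<in> gap_metrics X \<rho> K r \<and> e \<in> T" using e(1) eM s(2) T'(2) by auto
  qed
qed

section \<open>Rigidity and the Baire category argument\<close>

lemma rigid_metricI:
  assumes three: "{0::nat, 1, 2} \<lesssim> topspace X"
    and sep: "\<And>x y u v. \<lbrakk>x \<in> topspace X; y \<in> topspace X; u \<in> topspace X; v \<in> topspace X;
      x \<noteq> y; x \<noteq> u; y \<noteq> u\<rbrakk> \<Longrightarrow> d x y \<noteq> d u v"
  shows "rigid_metric X d"
  unfolding rigid_metric_def
proof (intro allI impI ballI, elim conjE)
  fix f x
  assume f: "bij_betw f (topspace X) (topspace X)"
    and iso: "\<forall>x\<in>topspace X. \<forall>y\<in>topspace X. d (f x) (f y) = d x y" and x: "x \<in> topspace X"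
  obtain g :: "nat \<Rightarrow> 'a" where g: "inj_on g {0, 1, 2}" "g ` {0, 1, 2} \<subseteq> topspace X"
    using three unfolding lepoll_def by auto
  then have "g 0 \<noteq> g 1" "g 0 \<noteq> g 2" "g 1 \<noteq> g 2" "g 0 \<in> topspace X" "g 1 \<in> topspace X" "g 2 \<in> topspace X"
    by auto
  \<comment> \<open>Among three distinct points at least two differ from \<open>x\<close>.\<close>
  then obtain y z where yz: "y \<in> topspace X" "z \<in> topspace X" "x \<noteq> y" "x \<noteq> z" "y \<noteq> z"
    by metis
  have fX: "f w \<in> topspace X" if "w \<in> topspace X" for w
    using f that by (rule bij_betw_apply)
  \<comment> \<open>\<open>sep\<close> is applied to \<open>x, w, f x, f w\<close>: were
    \<open>f x\<close> outside \<open>{x, w}\<close>, the isometry would violate it. Two different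
    choices of \<open>w\<close> leave only \<open>f x = x\<close>.\<close>
  have "f x = x \<or> f x = w" if w: "w \<in> topspace X" "x \<noteq> w" for w
    using sep[OF x w(1) fX[OF x] fX[OF w(1)] w(2)] iso x w(1) by metis
  from this[OF yz(1,3)] this[OF yz(2,4)] yz(5) show "f x = x" by auto
qed

theorem theorem1p3:
  fixes X :: "'a topology"
  assumes "strongly_zero_dimensional X"
    and "metrizable_space X"
    and "sigma_compact_space X"
    and "{0::nat, 1, 2} \<lesssim> topspace X"
    and "topspace X \<lesssim> (UNIV :: real set)"
  shows "comeager_in (Met_topology X) (R X)"
proof -
  have H: "Hausdorff_space X" using assms(2) by (rule metrizable_imp_Hausdorff_space)
  have L: "Lindelof_space X" using assms(3) by (rule sigma_compact_imp_Lindelof)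
  obtain \<rho> where \<rho>: "Metric_space (topspace X) \<rho>" "Metric_space.mtopology (topspace X) \<rho> = X"
    by (rule metrizable_space_metric[OF assms(2)])
  interpret \<rho>: Metric_space "topspace X" \<rho> by fact
  obtain \<C> where \<C>: "countable \<C>" "\<forall>K\<in>\<C>. compactin X K" "\<Union>\<C> = topspace X"
    by (rule sigma_compact_spaceE[OF assms(3)])
  \<comment> \<open>Finite unions are taken so that any four points lie in one compact set; the
    family remains countable.\<close>
  define \<K> where "\<K> = Union ` {\<F>. finite \<F> \<and> \<F> \<subseteq> \<C>}"
  have \<K>: "compactin X K" if "K \<in> \<K>" for K
    using that \<C>(2) unfolding \<K>_def by (auto intro!: compactin_Union)
  have \<K>X: "K \<subseteq> topspace X" if "K \<in> \<K>" for K
    using \<K>[OF that] by (rule compactin_subset_topspace)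
  define \<G> where "\<G> = (\<lambda>(K, n). gap_metrics X \<rho> K (1 / real (Suc n))) ` (\<K> \<times> UNIV)"
  have "countable \<K>"
    unfolding \<K>_def using \<C>(1) by (intro countable_image countable_Collect_finite_subset)
  then have "countable \<G>" unfolding \<G>_def by auto
  \<comment> \<open>The empty union keeps \<open>\<G>\<close> nonempty and later yields
    \<open>d \<in> Met X\<close>.\<close>
  have "{} \<in> \<K>" unfolding \<K>_def by (intro image_eqI[of _ _ "{}"]) auto
  then have "\<G> \<noteq> {}" unfolding \<G>_def by auto
  have \<G>: "openin (Met_topology X) T \<and> Met_topology X closure_of T = topspace (Met_topology X)"
    if TG: "T \<in> \<G>" for T
  proof -
    obtain K n where K: "K \<in> \<K>" and T: "T = gap_metrics X \<rho> K (1 / real (Suc n))"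
      using TG by (auto simp: \<G>_def simp del: of_nat_Suc)
    show ?thesis
      unfolding T using openin_gap_metrics[OF H \<K>X[OF K]]
        closure_of_gap_metrics[OF assms(2,1) L \<rho> \<K>[OF K], of "1 / real (Suc n)"] by simp
  qed
  have "\<Inter>\<G> \<subseteq> R X"
  proof
    fix d assume d: "d \<in> \<Inter>\<G>"
    then have dG: "d \<in> gap_metrics X \<rho> K (1 / real (Suc n))" if "K \<in> \<K>" for K n
      using that unfolding \<G>_def by auto
    have "rigid_metric X d"
    proof (rule rigid_metricI[OF assms(4)])
      fix x y u v
      assume X: "x \<in> topspace X" "y \<in> topspace X" "u \<in> topspace X" "v \<in> topspace X"
        and ne: "x \<noteq> y" "x \<noteq> u" "y \<noteq> u"
      have cov: "\<exists>C. C \<in> \<C> \<and> w \<in> C" if "w \<in> topspace X" for w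
        using that unfolding \<C>(3)[symmetric] by (rule UnionE) (intro exI conjI)
      obtain Cx Cy Cu Cv where C: "Cx \<in> \<C>" "Cy \<in> \<C>" "Cu \<in> \<C>" "Cv \<in> \<C>"
          "x \<in> Cx" "y \<in> Cy" "u \<in> Cu" "v \<in> Cv"
        using cov[OF X(1)] cov[OF X(2)] cov[OF X(3)] cov[OF X(4)]
        by (elim exE conjE) (rule that)
      define K where "K = \<Union>{Cx, Cy, Cu, Cv}"
      have K: "K \<in> \<K>" "x \<in> K" "y \<in> K" "u \<in> K" "v \<in> K"
      proof -
        show "K \<in> \<K>" unfolding \<K>_def
          by (rule image_eqI[of _ _ "{Cx, Cy, Cu, Cv}"]) (simp_all add: K_def C)
      qed (simp_all add: K_def C)
      \<comment> \<open>A threshold below all three distances brings the points within the scope of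
        \<open>gap_metrics\<close>.\<close>
      have "0 < min (\<rho> x y) (min (\<rho> x u) (\<rho> y u))"
        using X ne by (simp add: \<rho>.mdist_pos_less)
      then obtain n where n: "1 / real (Suc n) < min (\<rho> x y) (min (\<rho> x u) (\<rho> y u))"
        using nat_approx_posE by metis
      obtain \<delta> where "\<delta> > 0" and "\<forall>x\<in>K. \<forall>y\<in>K. \<forall>u\<in>K. \<forall>v\<in>K.
          1 / real (Suc n) \<le> \<rho> x y \<and> 1 / real (Suc n) \<le> \<rho> x u \<and> 1 / real (Suc n) \<le> \<rho> y u \<longrightarrow>
          \<delta> \<le> \<bar>d x y - d u v\<bar>"
        using dG[OF K(1), of n] unfolding gap_metrics_def by blast
      then have "\<delta> \<le> \<bar>d x y - d u v\<bar>" using K(2-5) n by (simp del: of_nat_Suc)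
      with \<open>\<delta> > 0\<close> show "d x y \<noteq> d u v" by auto
    qed
    then show "d \<in> R X"
      using dG[OF \<open>{} \<in> \<K>\<close>] unfolding R_def gap_metrics_def by blast
  qed
  moreover have "gdelta_in (Met_topology X) (\<Inter>\<G>)"
    using \<open>countable \<G>\<close> \<open>\<G> \<noteq> {}\<close> \<G> by (intro gdelta_in_Inter open_imp_gdelta_in) auto
  moreover have "Met_topology X closure_of \<Inter>\<G> = topspace (Met_topology X)"
    using completely_metrizable_Met_topology[OF assms(2,3)] \<open>countable \<G>\<close> \<G>
    by (intro Baire_category) auto
  ultimately show ?thesis unfolding comeager_in_def by blast
qed

end
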